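(* Let $K(\Omega)$ be a quasi-$K_\sigma$-space of random variables with quasinorm $\|\cdot\|_K$ and majorizing characteristic $\mu(n)$. Let $(T,\rho)$ be a compact pseudometric space and $X=(X(t),t\in T)$ a random process with $X(t)\in K(\Omega)$ for all $t\in T$. Let $\sigma=\{\sigma(h),h\ge0\}$ be a continuous monotonically increasing function with $\sigma(0)=0$ such that $\sup_{\rho(t,s)\le h}\|X(t)-X(s)\|_K\le\sigma(h)$. Let $(\varepsilon_l)_{l\ge0}$ be a monotonically decreasing sequence with $\varepsilon_0=\sup_{t,s\in T}\rho(t,s)$ and $\varepsilon_l\to0$ as $l\to\infty$, and suppose $$\sum_{l=0}^\infty\mu\big(N_T(\varepsilon_{l+1})\big)\sigma(\varepsilon_l)<\infty .$$ If $X$ is a separable process, then $X$ is sample continuous with probability one.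
   Context: A quasinorm on a space $K(\Omega)$ of random variables is a functional $\|\cdot\|\ge0$ with: $\|\xi\|=0\iff\xi=0$ a.s.; $\|\xi+\eta\|\le\|\xi\|+\|\eta\|$; $\|\lambda\xi\|\le\|\xi\|$ for $|\lambda|\le1$. Throughout the quasinorm is subordinate to a monotonically non-decreasing $j:[0,1]\to[0,\infty)$ with $j(\lambda)\to0$ as $\lambda\to0$, i.e. $\|\lambda\xi\|\le j(|\lambda|)\|\xi\|$ for $|\lambda|\le1$. A quasi-Banach space is a space complete with respect to the quasinorm. A quasi-Banach space $K(\Omega)$ is a quasi-$K_\sigma$-space if: (a1) $\xi,\eta\in K(\Omega)$ implies $\max(\xi,\eta),\min(\xi,\eta)\in K(\Omega)$; (a2) if $\xi,\eta\in K(\Omega)$ and $|\xi|\le|\eta|$ a.s., then $\|\xi\|\le\|\eta\|$; (a3) if $\xi_n\in K(\Omega)$, $n\ge1$, and $\sup_n|\xi_n|\le\eta$ for some $\eta\in K(\Omega)$, then $\sup_n|\xi_n|\in K(\Omega)$. A non-decreasing numerical sequence $(\mu(n),n\ge1)$ is a majorizing characteristic of $K(\Omega)$ if $\|\max_{1\le i\le n}|\xi_i|\|\le\mu(n)\max_{1\le i\le n}\|\xi_i\|$ for all $\xi_1,\dots,\xi_n\in K(\Omega)$. $N_T(\varepsilon)$ is the minimal number of open balls of radius $\varepsilon$ covering $T$. Separability and sample continuity of the process are with respect to $(T,\rho)$. *)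

theory Defs
  imports "HOL-Probability.Probability"
begin

section \<open>Pseudometric spaces\<close>

text \<open>The library locale \<^locale>\<open>Metric_space\<close> demands that points at distance 0 coincide,
  so the (otherwise identical) pseudometric version is set up here.\<close>

locale pseudometric_space =
  fixes T :: "'t set" and \<rho> :: "'t \<Rightarrow> 't \<Rightarrow> real"
  assumes nonneg: "\<lbrakk>t \<in> T; s \<in> T\<rbrakk> \<Longrightarrow> 0 \<le> \<rho> t s"
    and refl: "t \<in> T \<Longrightarrow> \<rho> t t = 0"
    and commute: "\<lbrakk>t \<in> T; s \<in> T\<rbrakk> \<Longrightarrow> \<rho> t s = \<rho> s t"
    and triangle: "\<lbrakk>t \<in> T; s \<in> T; u \<in> T\<rbrakk> \<Longrightarrow> \<rho> t u \<le> \<rho> t s + \<rho> s u"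

definition pball :: "'t set \<Rightarrow> ('t \<Rightarrow> 't \<Rightarrow> real) \<Rightarrow> 't \<Rightarrow> real \<Rightarrow> 't set" where
  "pball T \<rho> t r = {s \<in> T. \<rho> t s < r}"

definition ptopology :: "'t set \<Rightarrow> ('t \<Rightarrow> 't \<Rightarrow> real) \<Rightarrow> 't topology" where
  "ptopology T \<rho> = topology (\<lambda>U. U \<subseteq> T \<and> (\<forall>t\<in>U. \<exists>r>0. pball T \<rho> t r \<subseteq> U))"

lemma openin_ptopology:
  "openin (ptopology T \<rho>) U \<longleftrightarrow> U \<subseteq> T \<and> (\<forall>t\<in>U. \<exists>r>0. pball T \<rho> t r \<subseteq> U)"
proof -
  have "istopology (\<lambda>U. U \<subseteq> T \<and> (\<forall>t\<in>U. \<exists>r>0. pball T \<rho> t r \<subseteq> U))"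
    unfolding istopology_def
  proof (intro conjI allI impI ballI)
    fix U V t
    assume "U \<subseteq> T \<and> (\<forall>t\<in>U. \<exists>r>0. pball T \<rho> t r \<subseteq> U)"
      and "V \<subseteq> T \<and> (\<forall>t\<in>V. \<exists>r>0. pball T \<rho> t r \<subseteq> V)" and "t \<in> U \<inter> V"
    then obtain r r' where "r > 0" "pball T \<rho> t r \<subseteq> U" "r' > 0" "pball T \<rho> t r' \<subseteq> V"
      by blast
    then show "\<exists>r>0. pball T \<rho> t r \<subseteq> U \<inter> V"
      by (intro exI[of _ "min r r'"]) (auto simp: pball_def)
  qed (blast, blast, meson Union_upper Union_iff subset_trans)
  then show ?thesis
    by (simp add: ptopology_def topology_inverse')
qed

lemma topspace_ptopology: "topspace (ptopology T \<rho>) = T"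
proof -
  have "openin (ptopology T \<rho>) T"
    unfolding openin_ptopology by (auto simp: pball_def intro: exI[of _ 1])
  then show ?thesis
    by (meson openin_ptopology openin_subset openin_topspace subset_antisym)
qed

text \<open>Meaningful when \<open>T\<close> is totally bounded and \<open>\<epsilon> > 0\<close>, so that finite covers exist.\<close>

definition covering_number :: "'t set \<Rightarrow> ('t \<Rightarrow> 't \<Rightarrow> real) \<Rightarrow> real \<Rightarrow> nat" where
  "covering_number T \<rho> \<epsilon> =
     (LEAST n. \<exists>C. C \<subseteq> T \<and> finite C \<and> card C = n \<and> T \<subseteq> (\<Union>c\<in>C. pball T \<rho> c \<epsilon>))"

section \<open>Quasi-\<open>K\<^sub>\<sigma>\<close>-spaces of random variables\<close>

text \<open>Elements of \<open>K\<close> are functions, not classes modulo almost sure equality. \<open>K\<close> is not required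
  to contain every version of its elements; \<open>qn\<close> depends only on the class, by
  \<open>qn_eq_0_iff\<close> and \<open>qn_triangle\<close>.\<close>

locale quasinormed_rv_space = prob_space M
  for M :: "'a measure" +
  fixes K :: "('a \<Rightarrow> real) set" and qn :: "('a \<Rightarrow> real) \<Rightarrow> real" and j :: "real \<Rightarrow> real"
  assumes K_random_variable: "\<xi> \<in> K \<Longrightarrow> \<xi> \<in> borel_measurable M"
    and K_zero: "(\<lambda>\<omega>. 0) \<in> K"
    and K_add: "\<lbrakk>\<xi> \<in> K; \<eta> \<in> K\<rbrakk> \<Longrightarrow> (\<lambda>\<omega>. \<xi> \<omega> + \<eta> \<omega>) \<in> K"
    and K_scale: "\<xi> \<in> K \<Longrightarrow> (\<lambda>\<omega>. c * \<xi> \<omega>) \<in> K"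
    and qn_nonneg: "\<xi> \<in> K \<Longrightarrow> 0 \<le> qn \<xi>"
    and qn_eq_0_iff: "\<xi> \<in> K \<Longrightarrow> qn \<xi> = 0 \<longleftrightarrow> (AE \<omega> in M. \<xi> \<omega> = 0)"
    and qn_triangle: "\<lbrakk>\<xi> \<in> K; \<eta> \<in> K\<rbrakk> \<Longrightarrow> qn (\<lambda>\<omega>. \<xi> \<omega> + \<eta> \<omega>) \<le> qn \<xi> + qn \<eta>"
    and qn_scale_le: "\<lbrakk>\<xi> \<in> K; \<bar>c\<bar> \<le> 1\<rbrakk> \<Longrightarrow> qn (\<lambda>\<omega>. c * \<xi> \<omega>) \<le> qn \<xi>"
    and j_nonneg: "c \<in> {0..1} \<Longrightarrow> 0 \<le> j c"
    and j_mono: "mono_on {0..1} j"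
    and j_tendsto_0: "(j \<longlongrightarrow> 0) (at 0 within {0..1})"
    and qn_subordinate: "\<lbrakk>\<xi> \<in> K; \<bar>c\<bar> \<le> 1\<rbrakk> \<Longrightarrow> qn (\<lambda>\<omega>. c * \<xi> \<omega>) \<le> j \<bar>c\<bar> * qn \<xi>"

locale quasi_banach_rv_space = quasinormed_rv_space +
  assumes complete:
    "\<And>\<xi> :: nat \<Rightarrow> 'a \<Rightarrow> real.
       \<lbrakk>\<And>n. \<xi> n \<in> K; \<forall>e>0. \<exists>N. \<forall>m\<ge>N. \<forall>n\<ge>N. qn (\<lambda>\<omega>. \<xi> m \<omega> - \<xi> n \<omega>) < e\<rbrakk>
       \<Longrightarrow> \<exists>\<eta>\<in>K. (\<lambda>n. qn (\<lambda>\<omega>. \<xi> n \<omega> - \<eta> \<omega>)) \<longlonglongrightarrow> 0"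

text \<open>In \<open>K_countable_Sup\<close> the supremum is finite only almost surely, hence determined only
  almost surely.\<close>

locale quasi_Ksigma_space = quasi_banach_rv_space +
  assumes K_max: "\<lbrakk>\<xi> \<in> K; \<eta> \<in> K\<rbrakk> \<Longrightarrow> (\<lambda>\<omega>. max (\<xi> \<omega>) (\<eta> \<omega>)) \<in> K"
    and K_min: "\<lbrakk>\<xi> \<in> K; \<eta> \<in> K\<rbrakk> \<Longrightarrow> (\<lambda>\<omega>. min (\<xi> \<omega>) (\<eta> \<omega>)) \<in> K"
    and qn_mono: "\<lbrakk>\<xi> \<in> K; \<eta> \<in> K; AE \<omega> in M. \<bar>\<xi> \<omega>\<bar> \<le> \<bar>\<eta> \<omega>\<bar>\<rbrakk> \<Longrightarrow> qn \<xi> \<le> qn \<eta>"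
    and K_countable_Sup:
      "\<And>(\<xi> :: nat \<Rightarrow> 'a \<Rightarrow> real) \<eta>.
         \<lbrakk>\<And>n. \<xi> n \<in> K; \<eta> \<in> K; AE \<omega> in M. \<forall>n. \<bar>\<xi> n \<omega>\<bar> \<le> \<eta> \<omega>\<rbrakk>
         \<Longrightarrow> \<exists>\<zeta>\<in>K. AE \<omega> in M. \<zeta> \<omega> = (SUP n. \<bar>\<xi> n \<omega>\<bar>)"

definition majorizing_characteristic ::
    "('a \<Rightarrow> real) set \<Rightarrow> (('a \<Rightarrow> real) \<Rightarrow> real) \<Rightarrow> (nat \<Rightarrow> real) \<Rightarrow> bool" where
  "majorizing_characteristic K qn \<mu> \<longleftrightarrow>
     mono_on {1..} \<mu> \<and>
     (\<forall>n\<ge>1. \<forall>\<xi> :: nat \<Rightarrow> 'a \<Rightarrow> real. (\<forall>i\<in>{1..n}. \<xi> i \<in> K) \<longrightarrow>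
        qn (\<lambda>\<omega>. MAX i\<in>{1..n}. \<bar>\<xi> i \<omega>\<bar>) \<le> \<mu> n * (MAX i\<in>{1..n}. qn (\<xi> i)))"

section \<open>Separability and sample continuity\<close>

text \<open>Separability in the sense of Doob, relative to the closed sets.\<close>

definition separable_process ::
    "'a measure \<Rightarrow> 't topology \<Rightarrow> ('t \<Rightarrow> 'a \<Rightarrow> real) \<Rightarrow> bool" where
  "separable_process M \<T> X \<longleftrightarrow>
     (\<exists>S N. countable S \<and> S \<subseteq> topspace \<T> \<and> \<T> closure_of S = topspace \<T> \<and> N \<in> null_sets M \<and>
        (\<forall>U F. openin \<T> U \<longrightarrow> closed F \<longrightarrow>
           {\<omega> \<in> space M. \<forall>t \<in> U \<inter> S. X t \<omega> \<in> F} - {\<omega> \<in> space M. \<forall>t \<in> U. X t \<omega> \<in> F} \<subseteq> N))"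

definition sample_continuous_AE ::
    "'a measure \<Rightarrow> 't topology \<Rightarrow> ('t \<Rightarrow> 'a \<Rightarrow> real) \<Rightarrow> bool" where
  "sample_continuous_AE M \<T> X \<longleftrightarrow>
     (AE \<omega> in M. continuous_map \<T> euclideanreal (\<lambda>t. X t \<omega>))"

end

theory Submission
  imports Defs
begin

text \<open>
  The theorem is an instance of the chaining method. For every level \<open>l\<close> fix a minimal
  \<open>\<epsilon> l\<close>-net \<open>S l\<close> of \<open>T\<close> and a map \<open>\<pi> l\<close> into it that moves every point by less than \<open>\<epsilon> l\<close>;
  write \<open>N (\<epsilon> l)\<close> for the size of \<open>S l\<close>. The largest increment
  \<open>\<bar>X u - X (\<pi> l u)\<bar>\<close> over the \<open>N (\<epsilon> (l + 1))\<close> points \<open>u\<close> of the next net has quasinorm at most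
  \<open>\<mu> (N (\<epsilon> (l + 1))) * \<sigma> (\<epsilon> l)\<close>, the \<open>l\<close>-th term of the series. In a quasi-\<open>K\<^sub>\<sigma>\<close>-space a series of
  random variables whose quasinorms are summable converges absolutely almost surely
  (\<open>AE_summable_of_summable_qn\<close>): completeness provides a limit of the partial sums of the
  absolute values, and monotonicity of the quasinorm makes that limit an almost surely finite
  upper bound. Hence, with probability one, descending from a net point of arbitrarily fine
  level down to level \<open>m\<close> changes \<open>X\<close> by at most a tail \<open>R m\<close> that tends to 0.

  Two close points \<open>u\<close>, \<open>v\<close> descend to a pair in \<open>S m \<times> S m\<close>, but the points of that pair need not
  be close: nothing bounds the sum of the radii \<open>\<epsilon> l\<close>. Instead, each of the finitely many pairs
  that arises in this way gets one representative \<open>(u', v')\<close> of close points above it. Going down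
  from \<open>u\<close>, up to \<open>u'\<close>, across to \<open>v'\<close>, down again and up to \<open>v\<close> gives
  \<open>\<bar>X u - X v\<bar> \<le> 4 * R m + P m\<close>, where \<open>P m\<close> is the largest increment over the representatives.
  The number of representatives depends on \<open>m\<close> only, so \<open>P m\<close> has quasinorm at most
  \<open>\<mu> ((card (S m))\<^sup>2) * \<sigma> (\<delta> m)\<close>, which is as small as desired once ``close'' means closer than a
  suitable \<open>\<delta> m\<close>; in particular \<open>P m\<close> tends to 0 almost surely.

  Since \<open>\<mu> \<ge> 1\<close> outside a degenerate case, also the \<open>\<sigma> (\<epsilon> l)\<close> are summable, so
  \<open>X (\<pi> l t)\<close> tends to \<open>X t\<close> almost surely for each fixed \<open>t\<close>. Therefore \<open>X\<close> is almost surely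
  uniformly continuous on every countable set (\<open>AE_uniformly_continuous_on_countable\<close>), and
  separability transfers continuity from a countable dense set to all of \<open>T\<close>.
\<close>

section \<open>Finite nets in compact pseudometric spaces\<close>

lemma (in pseudometric_space) openin_pball:
  assumes "t \<in> T"
  shows "openin (ptopology T \<rho>) (pball T \<rho> t r)"
  unfolding openin_ptopology
proof (intro conjI ballI)
  show "pball T \<rho> t r \<subseteq> T" by (auto simp: pball_def)
  fix s assume s: "s \<in> pball T \<rho> t r"
  have "pball T \<rho> s (r - \<rho> t s) \<subseteq> pball T \<rho> t r"
    using s assms triangle[of t s] by (fastforce simp: pball_def)
  then show "\<exists>q>0. pball T \<rho> s q \<subseteq> pball T \<rho> t r"
    using s by (intro exI[of _ "r - \<rho> t s"]) (auto simp: pball_def)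
qed

lemma (in pseudometric_space) obtain_minimal_net:
  assumes "compact_space (ptopology T \<rho>)" "0 < e"
  obtains C where "C \<subseteq> T" "finite C" "card C = covering_number T \<rho> e"
    "T \<subseteq> (\<Union>c\<in>C. pball T \<rho> c e)"
proof -
  have "\<forall>U\<in>(\<lambda>c. pball T \<rho> c e) ` T. openin (ptopology T \<rho>) U"
    using openin_pball by blast
  moreover have "topspace (ptopology T \<rho>) \<subseteq> \<Union> ((\<lambda>c. pball T \<rho> c e) ` T)"
    using assms(2) refl by (force simp: topspace_ptopology pball_def)
  ultimately obtain F where F: "finite F" "F \<subseteq> (\<lambda>c. pball T \<rho> c e) ` T"
      "topspace (ptopology T \<rho>) \<subseteq> \<Union>F"
    using assms(1) unfolding compact_space_alt by meson
  then obtain C where "C \<subseteq> T" "finite C" "F = (\<lambda>c. pball T \<rho> c e) ` C"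
    by (meson finite_subset_image)
  then have "\<exists>n C. C \<subseteq> T \<and> finite C \<and> card C = n \<and> T \<subseteq> (\<Union>c\<in>C. pball T \<rho> c e)"
    using F(3) by (auto simp: topspace_ptopology)
  from LeastI_ex[OF this] that show thesis
    unfolding covering_number_def by blast
qed

section \<open>Quasi-\<open>K\<^sub>\<sigma>\<close>-spaces\<close>

context quasi_Ksigma_space
begin

lemma K_diff: "\<lbrakk>\<xi> \<in> K; \<eta> \<in> K\<rbrakk> \<Longrightarrow> (\<lambda>\<omega>. \<xi> \<omega> - \<eta> \<omega>) \<in> K"
  using K_add[of \<xi> "\<lambda>\<omega>. (-1) * \<eta> \<omega>"] K_scale[of \<eta> "-1"] by simp

lemma K_abs:
  assumes "\<xi> \<in> K"
  shows "(\<lambda>\<omega>. \<bar>\<xi> \<omega>\<bar>) \<in> K"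
proof -
  have "(\<lambda>\<omega>. \<bar>\<xi> \<omega>\<bar>) = (\<lambda>\<omega>. max (\<xi> \<omega>) ((-1) * \<xi> \<omega>))" by auto
  then show ?thesis using K_max[OF assms K_scale[OF assms, of "-1"]] by simp
qed

lemma qn_zero: "qn (\<lambda>\<omega>. 0) = 0"
  using qn_eq_0_iff[OF K_zero] by simp

lemma qn_abs: "\<xi> \<in> K \<Longrightarrow> qn (\<lambda>\<omega>. \<bar>\<xi> \<omega>\<bar>) = qn \<xi>"
  by (intro antisym qn_mono K_abs) auto

lemma K_sum: "(\<And>i. i \<in> I \<Longrightarrow> \<xi> i \<in> K) \<Longrightarrow> (\<lambda>\<omega>. \<Sum>i\<in>I. \<xi> i \<omega>) \<in> K"
  by (induction I rule: infinite_finite_induct) (auto intro: K_zero K_add)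

lemma qn_sum:
  "(\<And>i. i \<in> I \<Longrightarrow> \<xi> i \<in> K) \<Longrightarrow> qn (\<lambda>\<omega>. \<Sum>i\<in>I. \<xi> i \<omega>) \<le> (\<Sum>i\<in>I. qn (\<xi> i))"
proof (induction I rule: infinite_finite_induct)
  case (insert i I)
  then show ?case
    using qn_triangle[of "\<xi> i" "\<lambda>\<omega>. \<Sum>i\<in>I. \<xi> i \<omega>"] K_sum[of I \<xi>] by fastforce
qed (simp_all add: qn_zero)

lemma K_Max:
  assumes "finite I" "I \<noteq> {}" "\<And>i. i \<in> I \<Longrightarrow> \<xi> i \<in> K"
  shows "(\<lambda>\<omega>. MAX i\<in>I. \<xi> i \<omega>) \<in> K"
  using assms
proof (induction I rule: finite_ne_induct)
  case (insert i I)
  then show ?case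
    using K_max[of "\<xi> i" "\<lambda>\<omega>. MAX i\<in>I. \<xi> i \<omega>"] by simp
qed simp

text \<open>The partial sums of \<open>\<bar>\<xi> n\<bar>\<close> are Cauchy, so they have a limit \<open>\<eta>\<close> in quasinorm. Because they
  increase, the positive part of (partial sum - \<open>\<eta>\<close>) is dominated by the distance of every later
  partial sum to \<open>\<eta>\<close>; its quasinorm is therefore 0, so \<open>\<eta>\<close> bounds every partial sum.\<close>

lemma AE_summable_of_summable_qn:
  assumes K: "\<And>n. \<xi> n \<in> K" and sm: "summable (\<lambda>n. qn (\<xi> n))"
  shows "AE \<omega> in M. summable (\<lambda>n::nat. \<bar>\<xi> n \<omega>\<bar>)"
proof -
  define s where "s n \<omega> = (\<Sum>i<n. \<bar>\<xi> i \<omega>\<bar>)" for n \<omega>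
  have sK: "s n \<in> K" for n
    unfolding s_def by (intro K_sum K_abs K)
  have dist: "qn (\<lambda>\<omega>. s n \<omega> - s m \<omega>) \<le> (\<Sum>i=m..<n. qn (\<xi> i))" if "m \<le> n" for m n
  proof -
    have "(\<lambda>\<omega>. s n \<omega> - s m \<omega>) = (\<lambda>\<omega>. \<Sum>i=m..<n. \<bar>\<xi> i \<omega>\<bar>)"
      using that by (auto simp: s_def fun_eq_iff sum_diff_nat_ivl simp flip: atLeast0LessThan)
    then show ?thesis
      using qn_sum[of "{m..<n}" "\<lambda>i \<omega>. \<bar>\<xi> i \<omega>\<bar>"] K_abs[OF K] by (simp add: qn_abs K)
  qed
  have sym: "qn (\<lambda>\<omega>. s n \<omega> - s m \<omega>) = qn (\<lambda>\<omega>. s m \<omega> - s n \<omega>)" for m n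
    by (intro antisym qn_mono K_diff sK) auto
  have "\<forall>e>0. \<exists>N. \<forall>m\<ge>N. \<forall>n\<ge>N. qn (\<lambda>\<omega>. s m \<omega> - s n \<omega>) < e"
  proof (intro allI impI)
    fix e :: real assume "0 < e"
    then obtain N where N: "\<And>m n. m \<ge> N \<Longrightarrow> norm (\<Sum>i=m..<n. qn (\<xi> i)) < e"
      using sm unfolding summable_Cauchy by blast
    have "qn (\<lambda>\<omega>. s m \<omega> - s n \<omega>) < e" if "m \<ge> N" "n \<ge> N" for m n
    proof (cases "m \<le> n")
      case True
      then show ?thesis using dist[OF True] N[of m n] that sym[of n m] by auto
    next
      case False
      then show ?thesis using dist[of n m] N[of n m] that by auto
    qed
    then show "\<exists>N. \<forall>m\<ge>N. \<forall>n\<ge>N. qn (\<lambda>\<omega>. s m \<omega> - s n \<omega>) < e" by blast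
  qed
  then obtain \<eta> where \<eta>: "\<eta> \<in> K" "(\<lambda>n. qn (\<lambda>\<omega>. s n \<omega> - \<eta> \<omega>)) \<longlonglongrightarrow> 0"
    using complete[of s] sK by blast
  have "AE \<omega> in M. s m \<omega> \<le> \<eta> \<omega>" for m
  proof -
    let ?p = "\<lambda>\<omega>. max (s m \<omega> - \<eta> \<omega>) 0"
    have pK: "?p \<in> K"
      by (intro K_max K_diff sK \<eta> K_zero)
    have "qn ?p \<le> qn (\<lambda>\<omega>. s n \<omega> - \<eta> \<omega>)" if "m \<le> n" for n
    proof (intro qn_mono pK K_diff sK \<eta> AE_I2)
      fix \<omega>
      have "s m \<omega> \<le> s n \<omega>"
        using that unfolding s_def by (intro sum_mono2) auto
      then show "\<bar>?p \<omega>\<bar> \<le> \<bar>s n \<omega> - \<eta> \<omega>\<bar>" by auto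
    qed
    then have "qn ?p \<le> 0"
      by (intro tendsto_lowerbound[OF \<eta>(2)]) (auto simp: eventually_sequentially)
    then have "AE \<omega> in M. ?p \<omega> = 0"
      using qn_eq_0_iff[OF pK] qn_nonneg[OF pK] by simp
    then show ?thesis by eventually_elim auto
  qed
  then have "AE \<omega> in M. \<forall>m. s m \<omega> \<le> \<eta> \<omega>"
    by (simp add: AE_all_countable)
  then show ?thesis
    by eventually_elim (auto simp: s_def intro!: summableI_nonneg_bounded)
qed

corollary AE_tendsto_0_of_summable_bound:
  assumes "\<And>n. \<xi> n \<in> K" "\<And>n. qn (\<xi> n) \<le> a n" "summable a"
  shows "AE \<omega> in M. (\<lambda>n::nat. \<xi> n \<omega>) \<longlonglongrightarrow> 0"
proof -
  have "summable (\<lambda>n. qn (\<xi> n))"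
    using assms qn_nonneg by (intro summable_comparison_test'[OF assms(3), of 0]) auto
  from AE_summable_of_summable_qn[OF assms(1) this] show ?thesis
    by eventually_elim (rule tendsto_rabs_zero_cancel[OF summable_LIMSEQ_zero])
qed

section \<open>Finite maxima and the majorizing characteristic\<close>

text \<open>A single random variable of positive quasinorm forces \<open>\<mu> 1 \<ge> 1\<close>.\<close>

lemma majorizing_characteristic_ge_1:
  assumes "majorizing_characteristic K qn \<mu>" "\<xi> \<in> K" "qn \<xi> \<noteq> 0" "1 \<le> n"
  shows "1 \<le> \<mu> n"
proof -
  have "\<forall>\<xi> :: nat \<Rightarrow> 'a \<Rightarrow> real. (\<forall>i\<in>{1..1}. \<xi> i \<in> K) \<longrightarrow>
        qn (\<lambda>\<omega>. MAX i\<in>{1..1}. \<bar>\<xi> i \<omega>\<bar>) \<le> \<mu> 1 * (MAX i\<in>{1..1}. qn (\<xi> i))"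
    using assms(1) unfolding majorizing_characteristic_def by blast
  from this[rule_format, of "\<lambda>_. \<xi>"] assms(2) have "qn \<xi> \<le> \<mu> 1 * qn \<xi>"
    by (simp add: qn_abs)
  then have "1 \<le> \<mu> 1"
    using qn_nonneg[OF assms(2)] assms(3) by (simp add: mult_le_cancel_right1)
  also have "\<mu> 1 \<le> \<mu> n"
    using assms(1,4) mono_onD[of "{1..}" \<mu> 1 n] unfolding majorizing_characteristic_def by simp
  finally show ?thesis .
qed

lemma finite_family_majorant:
  assumes mu: "majorizing_characteristic K qn \<mu>" and mu0: "0 \<le> \<mu> n"
    and I: "finite I" "card I \<le> n"
    and \<xi>: "\<And>i. i \<in> I \<Longrightarrow> \<xi> i \<in> K" "\<And>i. i \<in> I \<Longrightarrow> qn (\<xi> i) \<le> c" and c: "0 \<le> c"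
  obtains \<zeta> where "\<zeta> \<in> K" "qn \<zeta> \<le> \<mu> n * c" "\<And>i \<omega>. i \<in> I \<Longrightarrow> \<bar>\<xi> i \<omega>\<bar> \<le> \<zeta> \<omega>"
proof (cases "I = {}")
  case True
  then show thesis
    using that[of "\<lambda>_. 0"] K_zero qn_zero c mu0 by simp
next
  case False
  define k where "k = card I"
  have k: "1 \<le> k" "k \<le> n" using I False by (auto simp: k_def Suc_le_eq card_gt_0_iff)
  obtain f where f: "bij_betw f {1..k} I"
    unfolding k_def using ex_bij_betw_nat_finite_1[OF I(1)] by blast
  have fI: "f ` {1..k} = I" using f by (simp add: bij_betw_def)
  let ?\<zeta> = "\<lambda>\<omega>. MAX i\<in>{1..k}. \<bar>\<xi> (f i) \<omega>\<bar>"
  have fK: "\<xi> (f i) \<in> K" "qn (\<xi> (f i)) \<le> c" if "i \<in> {1..k}" for i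
    using that fI \<xi> by auto
  have "\<forall>\<xi>. (\<forall>i\<in>{1..k}. \<xi> i \<in> K) \<longrightarrow>
      qn (\<lambda>\<omega>. MAX i\<in>{1..k}. \<bar>\<xi> i \<omega>\<bar>) \<le> \<mu> k * (MAX i\<in>{1..k}. qn (\<xi> i))"
    using mu k(1) unfolding majorizing_characteristic_def by blast
  note * = this[THEN spec, of "\<lambda>i. \<xi> (f i)", THEN mp]
  have "qn ?\<zeta> \<le> \<mu> k * (MAX i\<in>{1..k}. qn (\<xi> (f i)))"
    by (rule *) (use fK(1) in blast)
  also have "\<dots> \<le> \<mu> n * c"
  proof (rule mult_mono)
    show "\<mu> k \<le> \<mu> n"
      using mu k mono_onD[of "{1..}" \<mu> k n] unfolding majorizing_characteristic_def by simp
    show "(MAX i\<in>{1..k}. qn (\<xi> (f i))) \<le> c"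
      using k(1) fK by (subst Max_le_iff) auto
    have "0 \<le> qn (\<xi> (f 1))" "qn (\<xi> (f 1)) \<le> (MAX i\<in>{1..k}. qn (\<xi> (f i)))"
      using k(1) fK qn_nonneg by (auto intro!: Max_ge)
    then show "0 \<le> (MAX i\<in>{1..k}. qn (\<xi> (f i)))" by linarith
  qed (fact mu0)
  finally have "qn ?\<zeta> \<le> \<mu> n * c" .
  moreover have "?\<zeta> \<in> K"
    using k(1) fK by (intro K_Max K_abs) auto
  moreover have "\<bar>\<xi> i \<omega>\<bar> \<le> ?\<zeta> \<omega>" if "i \<in> I" for i \<omega>
    using that fI by (intro Max_ge) auto
  ultimately show thesis using that by blast
qed

text \<open>This serves for infinite families: when the index set \<open>G\<close> is only known up to a classification
  \<open>c\<close> into \<open>n\<close> classes, one representative of each class can be controlled at the cost of \<open>\<mu> n\<close>.\<close>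

lemma representatives_majorant:
  assumes mu: "majorizing_characteristic K qn \<mu>" and mu0: "0 \<le> \<mu> n"
    and G: "finite (cls ` G)" "card (cls ` G) \<le> n"
    and \<xi>: "\<And>i. i \<in> G \<Longrightarrow> \<xi> i \<in> K" "\<And>i. i \<in> G \<Longrightarrow> qn (\<xi> i) \<le> c" and c: "0 \<le> c"
  obtains \<zeta> where "\<zeta> \<in> K" "qn \<zeta> \<le> \<mu> n * c"
    "\<And>i. i \<in> G \<Longrightarrow> \<exists>i'\<in>G. cls i' = cls i \<and> (\<forall>\<omega>. \<bar>\<xi> i' \<omega>\<bar> \<le> \<zeta> \<omega>)"
proof -
  define I where "I = inv_into G cls ` cls ` G"
  have IG: "I \<subseteq> G" unfolding I_def by (auto intro: inv_into_into)
  have I: "finite I" "card I \<le> n"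
    using G card_image_le[OF G(1), of "inv_into G cls"] by (auto simp: I_def)
  obtain \<zeta> where \<zeta>: "\<zeta> \<in> K" "qn \<zeta> \<le> \<mu> n * c" "\<And>i \<omega>. i \<in> I \<Longrightarrow> \<bar>\<xi> i \<omega>\<bar> \<le> \<zeta> \<omega>"
    using finite_family_majorant[OF mu mu0 I, of \<xi> c] \<xi> IG c by blast
  have "\<exists>i'\<in>G. cls i' = cls i \<and> (\<forall>\<omega>. \<bar>\<xi> i' \<omega>\<bar> \<le> \<zeta> \<omega>)" if "i \<in> G" for i
  proof (intro bexI[of _ "inv_into G cls (cls i)"] conjI allI)
    have "inv_into G cls (cls i) \<in> I" using that by (auto simp: I_def)
    then show "inv_into G cls (cls i) \<in> G" "\<And>\<omega>. \<bar>\<xi> (inv_into G cls (cls i)) \<omega>\<bar> \<le> \<zeta> \<omega>"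
      using IG \<zeta>(3) by auto
    show "cls (inv_into G cls (cls i)) = cls i" using that by (simp add: f_inv_into_f)
  qed
  with \<zeta> that show thesis by blast
qed

end

section \<open>Chaining\<close>

text \<open>\<open>descend \<pi> m j u\<close> leads a point \<open>u\<close> of level \<open>m + j\<close> through the levels
  \<open>m + j - 1, \<dots>, m\<close>, one approximation map at a time.\<close>

primrec descend :: "(nat \<Rightarrow> 't \<Rightarrow> 't) \<Rightarrow> nat \<Rightarrow> nat \<Rightarrow> 't \<Rightarrow> 't" where
  "descend \<pi> m 0 u = u"
| "descend \<pi> m (Suc j) u = descend \<pi> m j (\<pi> (m + j) u)"

lemma descend_in:
  assumes "\<And>l u. u \<in> S (Suc l) \<Longrightarrow> \<pi> l u \<in> S l" "u \<in> S (m + j)"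
  shows "descend \<pi> m j u \<in> S m"
  using assms(2) by (induction j arbitrary: u) (auto simp: assms(1))

lemma descend_increment:
  fixes x :: "'t \<Rightarrow> real"
  assumes "\<And>l u. u \<in> S (Suc l) \<Longrightarrow> \<pi> l u \<in> S l"
    and "\<And>l u. u \<in> S (Suc l) \<Longrightarrow> \<bar>x u - x (\<pi> l u)\<bar> \<le> \<Delta> l"
    and "u \<in> S (m + j)"
  shows "\<bar>x u - x (descend \<pi> m j u)\<bar> \<le> (\<Sum>l<j. \<Delta> (m + l))"
  using assms(3)
proof (induction j arbitrary: u)
  case (Suc j)
  have "\<bar>x u - x (\<pi> (m + j) u)\<bar> \<le> \<Delta> (m + j)"
    "\<bar>x (\<pi> (m + j) u) - x (descend \<pi> m j (\<pi> (m + j) u))\<bar> \<le> (\<Sum>l<j. \<Delta> (m + l))"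
    using Suc.prems by (auto intro!: assms(1,2) Suc.IH)
  then show ?case by simp
qed simp

text \<open>The part of the argument that concerns a single path \<open>x\<close>; the last hypothesis is what the
  representatives of close pairs provide.\<close>

lemma uniformly_continuous_by_chaining:
  fixes x :: "'t \<Rightarrow> real" and P \<Delta> :: "nat \<Rightarrow> real"
  assumes ps: "pseudometric_space T \<rho>" and A: "A \<subseteq> T" and S: "\<And>l. S l \<subseteq> T"
    and \<pi>: "\<And>l t. t \<in> T \<Longrightarrow> \<pi> l t \<in> S l" "\<And>l t. t \<in> T \<Longrightarrow> \<rho> (\<pi> l t) t < \<epsilon> l"
    and \<epsilon>: "\<epsilon> \<longlonglongrightarrow> 0" and \<delta>: "\<And>m. 0 < \<delta> m"
    and \<Delta>: "\<And>l u. u \<in> S (Suc l) \<Longrightarrow> \<bar>x u - x (\<pi> l u)\<bar> \<le> \<Delta> l" "summable (\<lambda>l. \<bar>\<Delta> l\<bar>)"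
    and lim: "\<And>t. t \<in> A \<Longrightarrow> (\<lambda>k. x t - x (\<pi> k t)) \<longlonglongrightarrow> 0"
    and P: "P \<longlonglongrightarrow> 0"
    and rep: "\<And>m j u v. \<lbrakk>u \<in> S (m + j); v \<in> S (m + j); \<rho> u v < \<delta> m\<rbrakk> \<Longrightarrow>
       \<exists>i u' v'. u' \<in> S (m + i) \<and> v' \<in> S (m + i) \<and> \<bar>x u' - x v'\<bar> \<le> P m \<and>
         descend \<pi> m i u' = descend \<pi> m j u \<and> descend \<pi> m i v' = descend \<pi> m j v"
    and e: "0 < e"
  shows "\<exists>d>0. \<forall>s\<in>A. \<forall>t\<in>A. \<rho> s t < d \<longrightarrow> \<bar>x s - x t\<bar> \<le> e"
proof -
  interpret pseudometric_space T \<rho> by (fact ps)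
  define R where "R m = (\<Sum>l. \<bar>\<Delta> (l + m)\<bar>)" for m
  have "R \<longlonglongrightarrow> 0"
    unfolding R_def using \<Delta>(2) by (rule suminf_exist_split2)
  then have "(\<lambda>m. 4 * R m + P m) \<longlonglongrightarrow> 4 * 0 + 0"
    by (intro tendsto_intros P)
  then have "\<forall>\<^sub>F m in sequentially. 4 * R m + P m < e"
    using e by (auto dest: order_tendstoD(2))
  then obtain m where m: "4 * R m + P m < e"
    by (auto simp: eventually_sequentially)
  have \<pi>S: "\<pi> l u \<in> S l" if "u \<in> S (Suc l)" for l u
    using that S \<pi>(1) by blast
  have down: "\<bar>x u - x (descend \<pi> m j u)\<bar> \<le> R m" if "u \<in> S (m + j)" for j u
  proof -
    have "\<bar>x u - x (descend \<pi> m j u)\<bar> \<le> (\<Sum>l<j. \<Delta> (m + l))"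
      by (rule descend_increment[where S = S]) (use that \<pi>S \<Delta>(1) in auto)
    also have "\<dots> \<le> (\<Sum>l<j. \<bar>\<Delta> (l + m)\<bar>)"
      by (intro sum_mono) (simp add: add.commute)
    also have "\<dots> \<le> R m"
      unfolding R_def using \<Delta>(2) by (intro sum_le_suminf) (auto simp: summable_iff_shift[of "\<lambda>l. \<bar>\<Delta> l\<bar>"])
    finally show ?thesis .
  qed
  have net: "\<bar>x u - x v\<bar> \<le> 4 * R m + P m"
    if uv: "u \<in> S (m + j)" "v \<in> S (m + j)" "\<rho> u v < \<delta> m" for j u v
  proof -
    obtain i u' v' where *: "u' \<in> S (m + i)" "v' \<in> S (m + i)" "\<bar>x u' - x v'\<bar> \<le> P m"
        "descend \<pi> m i u' = descend \<pi> m j u" "descend \<pi> m i v' = descend \<pi> m j v"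
      using rep[OF uv] by blast
    show ?thesis
      using down[OF uv(1)] down[OF uv(2)] down[OF *(1)] down[OF *(2)] *(3)
      unfolding *(4,5) by linarith
  qed
  have "\<bar>x s - x t\<bar> \<le> e" if st: "s \<in> A" "t \<in> A" "\<rho> s t < \<delta> m" for s t
  proof -
    have "(\<lambda>k. 2 * \<epsilon> k) \<longlonglongrightarrow> 2 * 0" by (intro tendsto_intros \<epsilon>)
    then have "\<forall>\<^sub>F k in sequentially. 2 * \<epsilon> k < \<delta> m - \<rho> s t"
      by (rule order_tendstoD(2)) (use st(3) in simp)
    then have "\<forall>\<^sub>F k in sequentially. \<bar>x (\<pi> k s) - x (\<pi> k t)\<bar> \<le> e"
      using eventually_ge_at_top[of m]
    proof eventually_elim
      case (elim k)
      have T: "s \<in> T" "t \<in> T" "\<pi> k s \<in> T" "\<pi> k t \<in> T" using st A \<pi>(1) S by blast+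
      have "\<rho> (\<pi> k s) (\<pi> k t) \<le> \<rho> (\<pi> k s) s + (\<rho> s t + \<rho> t (\<pi> k t))"
        using triangle[of "\<pi> k s" s "\<pi> k t"] triangle[of s t "\<pi> k t"] T by linarith
      also have "\<dots> < \<delta> m"
        using \<pi>(2)[OF T(1), of k] \<pi>(2)[OF T(2), of k] commute[OF T(2) T(4)] elim(1) by linarith
      finally have "\<bar>x (\<pi> k s) - x (\<pi> k t)\<bar> \<le> 4 * R m + P m"
        using net[of "\<pi> k s" "k - m" "\<pi> k t"] \<pi>(1) T elim(2) by simp
      then show ?case using m by linarith
    qed
    moreover have "(\<lambda>k. \<bar>(x s - x t) - (x s - x (\<pi> k s)) + (x t - x (\<pi> k t))\<bar>)
        \<longlonglongrightarrow> \<bar>(x s - x t) - 0 + 0\<bar>"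
      by (intro tendsto_intros lim st)
    ultimately show ?thesis
      by (intro tendsto_upperbound[of "\<lambda>k. \<bar>x (\<pi> k s) - x (\<pi> k t)\<bar>"]) auto
  qed
  then show ?thesis using \<delta>[of m] by blast
qed

lemma (in quasi_Ksigma_space) AE_uniformly_continuous_on_countable:
  fixes X :: "'t \<Rightarrow> 'a \<Rightarrow> real"
  assumes mu: "majorizing_characteristic K qn \<mu>" and mu1: "\<And>n. 1 \<le> n \<Longrightarrow> 1 \<le> \<mu> n"
    and ps: "pseudometric_space T \<rho>" and cpt: "compact_space (ptopology T \<rho>)" and T: "T \<noteq> {}"
    and X: "\<And>t. t \<in> T \<Longrightarrow> X t \<in> K"
    and \<sigma>: "continuous_on {0..} \<sigma>" "mono_on {0..} \<sigma>" "\<sigma> 0 = 0"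
    and inc: "\<And>h t s. \<lbrakk>0 \<le> h; t \<in> T; s \<in> T; \<rho> t s \<le> h\<rbrakk> \<Longrightarrow> qn (\<lambda>\<omega>. X t \<omega> - X s \<omega>) \<le> \<sigma> h"
    and \<epsilon>: "\<And>l. 0 < \<epsilon> l" "\<epsilon> \<longlonglongrightarrow> 0"
    and sm: "summable (\<lambda>l. \<mu> (covering_number T \<rho> (\<epsilon> (Suc l))) * \<sigma> (\<epsilon> l))"
    and A: "countable A" "A \<subseteq> T"
  shows "AE \<omega> in M. \<forall>e>0. \<exists>d>0. \<forall>s\<in>A. \<forall>t\<in>A. \<rho> s t < d \<longrightarrow> \<bar>X s \<omega> - X t \<omega>\<bar> \<le> e"
proof -
  interpret ps: pseudometric_space T \<rho> by (fact ps)
  have \<sigma>0: "0 \<le> \<sigma> h" if "0 \<le> h" for h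
    using mono_onD[OF \<sigma>(2), of 0 h] that \<sigma>(3) by simp
  have "\<forall>l. \<exists>C. C \<subseteq> T \<and> finite C \<and> card C = covering_number T \<rho> (\<epsilon> l) \<and>
      T \<subseteq> (\<Union>c\<in>C. pball T \<rho> c (\<epsilon> l))"
    using ps.obtain_minimal_net[OF cpt \<epsilon>(1)] by metis
  then obtain S where S: "\<And>l. S l \<subseteq> T" "\<And>l. finite (S l)"
      "\<And>l. card (S l) = covering_number T \<rho> (\<epsilon> l)" "\<And>l. T \<subseteq> (\<Union>c\<in>S l. pball T \<rho> c (\<epsilon> l))"
    by metis
  have "\<forall>l t. \<exists>c. t \<in> T \<longrightarrow> c \<in> S l \<and> \<rho> c t < \<epsilon> l"
    using S(4) by (fastforce simp: pball_def)
  then obtain \<pi> where \<pi>: "\<And>l t. t \<in> T \<Longrightarrow> \<pi> l t \<in> S l" "\<And>l t. t \<in> T \<Longrightarrow> \<rho> (\<pi> l t) t < \<epsilon> l"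
    by metis
  have N1: "1 \<le> card (S l)" for l
    using \<pi>(1) T S(2)[of l] by (force simp: Suc_le_eq card_gt_0_iff)
  have \<pi>T: "\<pi> l t \<in> T" if "t \<in> T" for l t using \<pi>(1) S(1) that by blast
  have \<pi>S: "\<pi> l u \<in> S l" if "u \<in> S (Suc l)" for l u
    using that S(1) \<pi>(1) by blast
  have step: "qn (\<lambda>\<omega>. X t \<omega> - X (\<pi> l t) \<omega>) \<le> \<sigma> (\<epsilon> l)" if "t \<in> T" for l t
    using \<pi>(2)[OF that, of l] ps.commute[OF that \<pi>T[OF that]] that \<pi>T \<epsilon>(1)[of l]
    by (intro inc) (auto intro: less_imp_le)

  have "\<exists>\<zeta>\<in>K. qn \<zeta> \<le> \<mu> (card (S (Suc l))) * \<sigma> (\<epsilon> l) \<and>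
      (\<forall>u\<in>S (Suc l). \<forall>\<omega>. \<bar>X u \<omega> - X (\<pi> l u) \<omega>\<bar> \<le> \<zeta> \<omega>)" for l
  proof -
    have *: "0 \<le> \<mu> (card (S (Suc l)))" using mu1[OF N1[of "Suc l"]] by linarith
    have ST: "u \<in> T" if "u \<in> S (Suc l)" for u using S(1) that by blast
    show ?thesis
    proof (rule finite_family_majorant[OF mu * S(2) order.refl])
      show "(\<lambda>\<omega>. X u \<omega> - X (\<pi> l u) \<omega>) \<in> K" if "u \<in> S (Suc l)" for u
        using ST[OF that] by (intro K_diff X \<pi>T)
      show "qn (\<lambda>\<omega>. X u \<omega> - X (\<pi> l u) \<omega>) \<le> \<sigma> (\<epsilon> l)" if "u \<in> S (Suc l)" for u
        using ST[OF that] by (rule step)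
      show "0 \<le> \<sigma> (\<epsilon> l)"
        using \<epsilon>(1)[of l] by (intro \<sigma>0) simp
    qed blast
  qed
  then obtain \<Delta> where \<Delta>: "\<And>l. \<Delta> l \<in> K" "\<And>l. qn (\<Delta> l) \<le> \<mu> (card (S (Suc l))) * \<sigma> (\<epsilon> l)"
      "\<And>l u \<omega>. u \<in> S (Suc l) \<Longrightarrow> \<bar>X u \<omega> - X (\<pi> l u) \<omega>\<bar> \<le> \<Delta> l \<omega>"
    by metis
  have sm': "summable (\<lambda>l. \<mu> (card (S (Suc l))) * \<sigma> (\<epsilon> l))"
    using sm by (simp add: S(3))
  have "summable (\<lambda>l. qn (\<Delta> l))"
    using \<Delta>(1,2) qn_nonneg by (intro summable_comparison_test'[OF sm', of 0]) auto
  then have AE\<Delta>: "AE \<omega> in M. summable (\<lambda>l. \<bar>\<Delta> l \<omega>\<bar>)"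
    using \<Delta>(1) by (intro AE_summable_of_summable_qn)

  have "\<sigma> (\<epsilon> l) \<le> \<mu> (card (S (Suc l))) * \<sigma> (\<epsilon> l)" for l
    using mult_right_mono[OF mu1[OF N1[of "Suc l"]] \<sigma>0[of "\<epsilon> l"]] \<epsilon>(1)[of l] by simp
  then have "summable (\<lambda>l. \<sigma> (\<epsilon> l))"
    using \<sigma>0 \<epsilon>(1) by (intro summable_comparison_test'[OF sm', of 0]) (auto simp: less_imp_le)
  then have "AE \<omega> in M. (\<lambda>k. X t \<omega> - X (\<pi> k t) \<omega>) \<longlonglongrightarrow> 0" if "t \<in> T" for t
    using that by (intro AE_tendsto_0_of_summable_bound[OF _ step] K_diff X \<pi>T)
  then have AElim: "AE \<omega> in M. \<forall>t\<in>A. (\<lambda>k. X t \<omega> - X (\<pi> k t) \<omega>) \<longlonglongrightarrow> 0"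
    using A by (auto simp: AE_ball_countable)

  \<comment> \<open>There are at most \<open>(card (S m))\<^sup>2\<close> pairs of end points at level \<open>m\<close>, hence as many
    representatives; \<open>\<delta> m\<close> is chosen to make their largest increment summable in \<open>m\<close>.\<close>
  let ?n = "\<lambda>m. card (S m) * card (S m)"
  have n1: "1 \<le> ?n m" for m using N1[of m] by simp
  have "\<exists>d>0. \<mu> (?n m) * \<sigma> d \<le> (1/2)^m" for m
  proof -
    have "(\<sigma> \<longlongrightarrow> \<sigma> 0) (at_right 0)"
      using \<sigma>(1) by (auto simp: continuous_on_def intro: tendsto_within_subset)
    then have "((\<lambda>d. \<mu> (?n m) * \<sigma> d) \<longlongrightarrow> \<mu> (?n m) * 0) (at_right 0)"
      unfolding \<sigma>(3) by (intro tendsto_intros)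
    then have "\<forall>\<^sub>F d in at_right 0. \<mu> (?n m) * \<sigma> d < (1/2)^m"
      by (rule order_tendstoD(2)) simp
    moreover have "\<forall>\<^sub>F d::real in at_right 0. 0 < d"
      by (rule eventually_at_right_less)
    ultimately have "\<forall>\<^sub>F d in at_right 0. 0 < d \<and> \<mu> (?n m) * \<sigma> d \<le> (1/2)^m"
      by eventually_elim auto
    then show ?thesis
      by (auto dest: eventually_happens)
  qed
  then obtain \<delta> where \<delta>: "\<And>m. 0 < \<delta> m" "\<And>m. \<mu> (?n m) * \<sigma> (\<delta> m) \<le> (1/2)^m"
    by metis
  define G where "G m = {(j, u, v). u \<in> S (m + j) \<and> v \<in> S (m + j) \<and> \<rho> u v < \<delta> m}" for m
  define cls where "cls m = (\<lambda>(j, u, v). (descend \<pi> m j u, descend \<pi> m j v))" for m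
  have "\<exists>\<zeta>\<in>K. qn \<zeta> \<le> (1/2)^m \<and>
      (\<forall>i\<in>G m. \<exists>i'\<in>G m. cls m i' = cls m i \<and>
        (\<forall>\<omega>. \<bar>X (fst (snd i')) \<omega> - X (snd (snd i')) \<omega>\<bar> \<le> \<zeta> \<omega>))" for m
  proof -
    have sub: "cls m ` G m \<subseteq> S m \<times> S m"
      using descend_in[where S = S and \<pi> = \<pi>, OF \<pi>S] by (auto simp: G_def cls_def)
    have fin: "finite (cls m ` G m)" "card (cls m ` G m) \<le> ?n m"
      using finite_subset[OF sub] card_mono[OF _ sub] S(2) by (auto simp: card_cartesian_product)
    have GT: "fst (snd i) \<in> T" "snd (snd i) \<in> T" "\<rho> (fst (snd i)) (snd (snd i)) \<le> \<delta> m"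
      if "i \<in> G m" for i
      using that by (auto simp: G_def dest: subsetD[OF S(1)])
    have *: "0 \<le> \<mu> (?n m)" using mu1[OF n1[of m]] by linarith
    have \<delta>0: "0 \<le> \<delta> m" using \<delta>(1)[of m] by simp
    show ?thesis
    proof (rule representatives_majorant[OF mu * fin])
      show "(\<lambda>\<omega>. X (fst (snd i)) \<omega> - X (snd (snd i)) \<omega>) \<in> K" if "i \<in> G m" for i
        using GT[OF that] by (intro K_diff X)
      show "qn (\<lambda>\<omega>. X (fst (snd i)) \<omega> - X (snd (snd i)) \<omega>) \<le> \<sigma> (\<delta> m)" if "i \<in> G m" for i
        using GT[OF that] \<delta>0 by (intro inc)
      show "0 \<le> \<sigma> (\<delta> m)" by (rule \<sigma>0[OF \<delta>0])
    next
      fix \<zeta>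
      assume \<zeta>: "\<zeta> \<in> K" "qn \<zeta> \<le> \<mu> (?n m) * \<sigma> (\<delta> m)"
        "\<And>i. i \<in> G m \<Longrightarrow> \<exists>i'\<in>G m. cls m i' = cls m i \<and>
          (\<forall>\<omega>. \<bar>X (fst (snd i')) \<omega> - X (snd (snd i')) \<omega>\<bar> \<le> \<zeta> \<omega>)"
      show ?thesis
        using \<zeta>(1,3) order.trans[OF \<zeta>(2) \<delta>(2)] by (intro bexI[of _ \<zeta>] conjI ballI)
    qed
  qed
  then obtain P where P: "\<And>m. P m \<in> K" "\<And>m. qn (P m) \<le> (1/2)^m"
      "\<And>m i. i \<in> G m \<Longrightarrow> \<exists>i'\<in>G m. cls m i' = cls m i \<and>
        (\<forall>\<omega>. \<bar>X (fst (snd i')) \<omega> - X (snd (snd i')) \<omega>\<bar> \<le> P m \<omega>)"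
    by metis
  have AEP: "AE \<omega> in M. (\<lambda>m. P m \<omega>) \<longlonglongrightarrow> 0"
    by (rule AE_tendsto_0_of_summable_bound[OF P(1,2)]) (simp add: summable_geometric)

  show ?thesis
    using AE\<Delta> AElim AEP
  proof eventually_elim
    case (elim \<omega>)
    show ?case
    proof (intro allI impI)
      fix e :: real assume "0 < e"
      show "\<exists>d>0. \<forall>s\<in>A. \<forall>t\<in>A. \<rho> s t < d \<longrightarrow> \<bar>X s \<omega> - X t \<omega>\<bar> \<le> e"
      proof (rule uniformly_continuous_by_chaining[where x = "\<lambda>t. X t \<omega>" and \<Delta> = "\<lambda>l. \<Delta> l \<omega>"
            and P = "\<lambda>m. P m \<omega>", OF ps A(2) S(1) \<pi> \<epsilon>(2) \<delta>(1) \<Delta>(3) elim(1) _ elim(3) _ \<open>0 < e\<close>])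
        show "\<exists>i u' v'. u' \<in> S (m + i) \<and> v' \<in> S (m + i) \<and> \<bar>X u' \<omega> - X v' \<omega>\<bar> \<le> P m \<omega> \<and>
            descend \<pi> m i u' = descend \<pi> m j u \<and> descend \<pi> m i v' = descend \<pi> m j v"
          if "u \<in> S (m + j)" "v \<in> S (m + j)" "\<rho> u v < \<delta> m" for m j u v
        proof -
          have "(j, u, v) \<in> G m" using that by (simp add: G_def)
          from P(3)[OF this] show ?thesis by (auto simp: G_def cls_def)
        qed
      qed (use elim(2) in auto)
    qed
  qed
qed

section \<open>From a separating set to the whole space\<close>

text \<open>On a small ball the values at the separating set lie in a short closed interval, and
  separability puts all values on the ball into the same interval.\<close>

lemma separable_sample_continuous:
  fixes X :: "'t \<Rightarrow> 'a \<Rightarrow> real"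
  assumes ps: "pseudometric_space T \<rho>" and sep: "separable_process M (ptopology T \<rho>) X"
    and unif: "\<And>A. countable A \<Longrightarrow> A \<subseteq> T \<Longrightarrow>
      AE \<omega> in M. \<forall>e>0. \<exists>d>0. \<forall>s\<in>A. \<forall>t\<in>A. \<rho> s t < d \<longrightarrow> \<bar>X s \<omega> - X t \<omega>\<bar> \<le> e"
  shows "sample_continuous_AE M (ptopology T \<rho>) X"
proof -
  interpret pseudometric_space T \<rho> by (fact ps)
  obtain A N where A: "countable A" "A \<subseteq> T" "ptopology T \<rho> closure_of A = T"
    and N: "N \<in> null_sets M"
    and sepN: "\<forall>U F. openin (ptopology T \<rho>) U \<longrightarrow> closed F \<longrightarrow>
       {\<omega> \<in> space M. \<forall>t \<in> U \<inter> A. X t \<omega> \<in> F} - {\<omega> \<in> space M. \<forall>t \<in> U. X t \<omega> \<in> F} \<subseteq> N"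
    using sep unfolding separable_process_def topspace_ptopology by (elim exE conjE) (rule that)
  show ?thesis
    unfolding sample_continuous_AE_def
    using unif[OF A(1,2)] AE_not_in[OF N] AE_space
  proof eventually_elim
    case (elim \<omega>)
    have osc: "\<exists>U. openin (ptopology T \<rho>) U \<and> t \<in> U \<and> (\<forall>s\<in>U. \<bar>X s \<omega> - X t \<omega>\<bar> < e)"
      if t: "t \<in> T" and e: "0 < e" for t e
    proof -
      obtain d where d: "0 < d" "\<And>s t. \<lbrakk>s \<in> A; t \<in> A; \<rho> s t < d\<rbrakk> \<Longrightarrow> \<bar>X s \<omega> - X t \<omega>\<bar> \<le> e / 3"
        using elim(1)[rule_format, of "e / 3"] e by auto
      let ?U = "pball T \<rho> t (d / 2)"
      have U: "openin (ptopology T \<rho>) ?U" "t \<in> ?U"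
        using openin_pball[OF t] t d(1) refl[OF t] by (blast, simp add: pball_def)
      obtain a where a: "a \<in> A" "a \<in> ?U"
        using A(3) t U by (metis in_closure_of)
      let ?F = "{X a \<omega> - e / 3 .. X a \<omega> + e / 3}"
      have "X s \<omega> \<in> ?F" if "s \<in> ?U \<inter> A" for s
      proof -
        have "\<rho> a s \<le> \<rho> a t + \<rho> t s" "\<rho> a t = \<rho> t a"
          using that a t by (auto simp: pball_def intro: triangle commute)
        then have "\<rho> a s < d" using that a by (auto simp: pball_def)
        then have "\<bar>X a \<omega> - X s \<omega>\<bar> \<le> e / 3" using d(2) that a(1) by blast
        then show ?thesis unfolding atLeastAtMost_iff by linarith
      qed
      then have F: "X s \<omega> \<in> ?F" if "s \<in> ?U" for s
        using sepN[rule_format, OF U(1), of ?F] elim(2,3) that by auto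
      have "\<bar>X s \<omega> - X t \<omega>\<bar> < e" if "s \<in> ?U" for s
        using F[OF that] F[OF U(2)] e unfolding atLeastAtMost_iff by linarith
      then show ?thesis using U by blast
    qed
    show ?case
      using osc
      by (auto simp: Met_TC.continuous_map_to_metric topspace_ptopology dist_real_def abs_minus_commute
          simp flip: mtopology_is_euclidean)
  qed
qed

theorem theorem1p3:
  fixes M :: "'a measure" and K :: "('a \<Rightarrow> real) set"
    and qn :: "('a \<Rightarrow> real) \<Rightarrow> real" and j :: "real \<Rightarrow> real" and \<mu> :: "nat \<Rightarrow> real"
    and T :: "'t set" and \<rho> :: "'t \<Rightarrow> 't \<Rightarrow> real" and X :: "'t \<Rightarrow> 'a \<Rightarrow> real"
    and \<sigma> :: "real \<Rightarrow> real" and \<epsilon> :: "nat \<Rightarrow> real"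
  assumes "quasi_Ksigma_space M K qn j"
    and "majorizing_characteristic K qn \<mu>"
    and "pseudometric_space T \<rho>"
    and "compact_space (ptopology T \<rho>)"
    and "\<And>t. t \<in> T \<Longrightarrow> X t \<in> K"
    and "continuous_on {0..} \<sigma>" and "mono_on {0..} \<sigma>" and "\<sigma> 0 = 0"
    and "\<And>h t s. \<lbrakk>0 \<le> h; t \<in> T; s \<in> T; \<rho> t s \<le> h\<rbrakk> \<Longrightarrow> qn (\<lambda>\<omega>. X t \<omega> - X s \<omega>) \<le> \<sigma> h"
    and "decseq \<epsilon>" and "\<And>l. 0 < \<epsilon> l"
    and "\<epsilon> 0 = (SUP (t, s) \<in> T \<times> T. \<rho> t s)" and "\<epsilon> \<longlonglongrightarrow> 0"
    and "summable (\<lambda>l. \<mu> (covering_number T \<rho> (\<epsilon> (Suc l))) * \<sigma> (\<epsilon> l))"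
    and "separable_process M (ptopology T \<rho>) X"
  shows "sample_continuous_AE M (ptopology T \<rho>) X"
proof -
  interpret quasi_Ksigma_space M K qn j by fact
  have unif: "AE \<omega> in M. \<forall>e>0. \<exists>d>0. \<forall>s\<in>A. \<forall>t\<in>A. \<rho> s t < d \<longrightarrow> \<bar>X s \<omega> - X t \<omega>\<bar> \<le> e"
    if A: "countable A" "A \<subseteq> T" for A
  proof (cases "\<exists>\<xi>\<in>K. qn \<xi> \<noteq> 0")
    case True
    show ?thesis
    proof (cases "T = {}")
      case True
      then show ?thesis using A(2) by (auto intro: exI[of _ 1])
    next
      case False
      have "1 \<le> \<mu> n" if "1 \<le> n" for n
        using majorizing_characteristic_ge_1[OF assms(2)] \<open>\<exists>\<xi>\<in>K. qn \<xi> \<noteq> 0\<close> that by blast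
      from AE_uniformly_continuous_on_countable[OF assms(2) this assms(3,4) False assms(5-9,11,13,14) A]
      show ?thesis .
    qed
  next
    \<comment> \<open>Here nothing bounds \<open>\<mu>\<close> from below, but every random variable in \<open>K\<close> vanishes almost surely.\<close>
    case False
    then have "AE \<omega> in M. X t \<omega> = 0" if "t \<in> A" for t
      using that A(2) assms(5) qn_eq_0_iff by blast
    then have "AE \<omega> in M. \<forall>t\<in>A. X t \<omega> = 0"
      using A(1) by (simp add: AE_ball_countable)
    then show ?thesis by eventually_elim (auto intro: exI[of _ 1])
  qed
  show ?thesis
    by (rule separable_sample_continuous[OF assms(3,15) unif])
qed

end
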